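(* Let $n\ge 1$. For every integer $0\le k\le 2^{n-1}$, $$(2k+1)\,\theta(n,k)\ge 2\sum_{i=0}^{k}\theta(n,i).$$
   Context: For $S\subset\{0,1\}^n$, $\theta(n,S)$ is the number of edges of the hypercube $Q_n$ (vertices $\{0,1\}^n$, adjacent iff differing in one coordinate) with exactly one endpoint in $S$; $\theta(n,k)=\min\{\theta(n,S): |S|=k\}$. *)

theory Defs
  imports Main
begin

definition cube_vertices :: "nat \<Rightarrow> bool list set" where
  "cube_vertices n = {v. length v = n}"

definition cube_adj :: "nat \<Rightarrow> bool list \<Rightarrow> bool list \<Rightarrow> bool" where
  "cube_adj n u v \<longleftrightarrow> u \<in> cube_vertices n \<and> v \<in> cube_vertices n \<and> card {i. i < n \<and> u ! i \<noteq> v ! i} = 1"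

definition cube_edges :: "nat \<Rightarrow> bool list set set" where
  "cube_edges n = {{u, v} | u v. cube_adj n u v}"

definition theta_set :: "nat \<Rightarrow> bool list set \<Rightarrow> nat" where
  "theta_set n S = card {e \<in> cube_edges n. card (e \<inter> S) = 1}"

(* The set under Min is finite, and it is nonempty exactly when k \<le> 2 ^ n. *)
definition theta :: "nat \<Rightarrow> nat \<Rightarrow> nat" where
  "theta n k = Min {theta_set n S | S. S \<subseteq> cube_vertices n \<and> card S = k}"

lemma finite_cube_vertices: "finite (cube_vertices n)"
  using finite_lists_length_eq[of "UNIV :: bool set" n] by (simp add: cube_vertices_def)

lemma card_cube_vertices: "card (cube_vertices n) = 2 ^ n"
  using card_lists_length_eq[of "UNIV :: bool set" n] by (simp add: cube_vertices_def)

lemma finite_theta_candidates: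
  "finite {theta_set n S | S. S \<subseteq> cube_vertices n \<and> card S = k}"
proof -
  have "{theta_set n S | S. S \<subseteq> cube_vertices n \<and> card S = k}
      \<subseteq> theta_set n ` Pow (cube_vertices n)"
    by auto
  then show ?thesis
    by (rule finite_subset) (simp add: finite_cube_vertices)
qed

lemma theta_candidates_nonempty:
  "{theta_set n S | S. S \<subseteq> cube_vertices n \<and> card S = k} \<noteq> {} \<longleftrightarrow> k \<le> 2 ^ n"
proof
  assume "{theta_set n S | S. S \<subseteq> cube_vertices n \<and> card S = k} \<noteq> {}"
  then show "k \<le> 2 ^ n"
    using card_mono[OF finite_cube_vertices[of n]] by (auto simp: card_cube_vertices)
next
  assume "k \<le> 2 ^ n"
  then obtain S where "S \<subseteq> cube_vertices n" "card S = k"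
    using obtain_subset_with_card_n[of k "cube_vertices n"] by (auto simp: card_cube_vertices)
  then show "{theta_set n S | S. S \<subseteq> cube_vertices n \<and> card S = k} \<noteq> {}"
    by blast
qed

end

theory Submission
  imports Defs "HOL-Library.Nat_Bijection"
begin

text \<open>
  By Harper's edge-isoperimetric theorem initial segments of the binary order are optimal, so
  passing from \<open>k\<close> to \<open>k + 1\<close> vertices changes \<open>theta n\<close> by \<open>n - 2 s k\<close>, where \<open>s\<close> counts binary
  ones. Weighting these increments by \<open>2 k + 1\<close> and summing turns the claim into
  \<open>2 (\<Sum>j<k. (2 j + 1) s j) \<le> n k\<^sup>2\<close>, which follows by removing the leading binary digit of \<open>k\<close>.
  Harper's theorem follows by cutting a vertex set along one coordinate, because the partial sums
  \<open>f k = (\<Sum>j<k. s j)\<close> satisfy \<open>f a + f b + min a b \<le> f (a + b)\<close>.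
\<close>

section \<open>Counting binary ones\<close>

definition popcount :: "nat \<Rightarrow> nat" where
  "popcount n = card (set_decode n)"

definition popcount_sum :: "nat \<Rightarrow> nat" where
  "popcount_sum k = (\<Sum>j<k. popcount j)"

definition weighted_popcount_sum :: "nat \<Rightarrow> nat" where
  "weighted_popcount_sum k = (\<Sum>j<k. (2 * j + 1) * popcount j)"

lemma popcount_rec: "popcount n = n mod 2 + popcount (n div 2)"
proof -
  have "i \<in> set_decode n \<longleftrightarrow> i \<in> (if odd n then {0} else {}) \<union> Suc ` set_decode (n div 2)" for i
    by (cases i) (simp_all add: inj_image_mem_iff)
  then have "set_decode n = (if odd n then {0} else {}) \<union> Suc ` set_decode (n div 2)"
    by blast
  then show ?thesis
    by (simp add: popcount_def card_insert_if card_image odd_iff_mod_2_eq_one)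
qed

lemma popcount_power2_add:
  assumes "r < 2 ^ m"
  shows "popcount (2 ^ m + r) = Suc (popcount r)"
proof -
  have "m \<notin> set_decode r"
    using assms by (simp add: set_decode_def)
  then show ?thesis
    by (simp add: popcount_def set_decode_plus_power_2)
qed

lemma popcount_sum_0 [simp]: "popcount_sum 0 = 0"
  by (simp add: popcount_sum_def)

lemma popcount_sum_Suc [simp]: "popcount_sum (Suc k) = popcount_sum k + popcount k"
  by (simp add: popcount_sum_def)

lemma weighted_popcount_sum_0 [simp]: "weighted_popcount_sum 0 = 0"
  by (simp add: weighted_popcount_sum_def)

lemma weighted_popcount_sum_Suc [simp]:
  "weighted_popcount_sum (Suc k) = weighted_popcount_sum k + (2 * k + 1) * popcount k"
  by (simp add: weighted_popcount_sum_def)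

lemma popcount_sum_halves:
  "popcount_sum k = popcount_sum (Suc k div 2) + popcount_sum (k div 2) + k div 2"
proof (induction k)
  case (Suc k)
  have "Suc k div 2 = k div 2 + k mod 2" "Suc (Suc k) div 2 = Suc (k div 2)"
    by presburger+
  then show ?case
    using Suc.IH popcount_rec[of k] by simp
qed simp

lemma popcount_sum_add_balanced:
  assumes "p \<le> Suc q" "q \<le> Suc p"
  shows "popcount_sum (p + q) = popcount_sum p + popcount_sum q + min p q"
proof (cases "q \<le> p")
  case True
  then have "Suc (p + q) div 2 = p" "(p + q) div 2 = q"
    using assms by linarith+
  then show ?thesis
    using popcount_sum_halves[of "p + q"] True by simp
next
  case False
  then have "Suc (p + q) div 2 = q" "(p + q) div 2 = p"
    using assms by linarith+
  then show ?thesis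
    using popcount_sum_halves[of "p + q"] False by simp
qed

lemma balanced_split:
  fixes k :: nat
  obtains p q where "k = p + q" "q \<le> p" "p \<le> Suc q"
  using that[of "Suc k div 2" "k div 2"] by linarith

lemma popcount_sum_superadditive:
  "popcount_sum a + popcount_sum b + min a b \<le> popcount_sum (a + b)"
proof (induction "a + b" arbitrary: a b rule: less_induct)
  case less
  show ?case
  proof (cases "a = 0 \<or> b = 0")
    case True
    then show ?thesis by auto
  next
    case False
    obtain p p' where a: "a = p + p'" "p' \<le> p" "p \<le> Suc p'"
      by (rule balanced_split)
    obtain q q' where b: "b = q' + q" "q \<le> q'" "q' \<le> Suc q"
      by (rule balanced_split)
    \<comment> \<open>Pairing the larger half of \<open>a\<close> with the smaller half of \<open>b\<close> keeps the sums balanced.\<close>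
    have "popcount_sum ((p + q) + (p' + q'))
        = popcount_sum (p + q) + popcount_sum (p' + q') + min (p + q) (p' + q')"
      using a b by (intro popcount_sum_add_balanced) linarith+
    then have "popcount_sum (a + b)
        = popcount_sum (p + q) + popcount_sum (p' + q') + min (p + q) (p' + q')"
      using a(1) b(1) by (simp add: ac_simps)
    moreover have "popcount_sum a = popcount_sum p + popcount_sum p' + min p p'"
      "popcount_sum b = popcount_sum q' + popcount_sum q + min q' q"
      using a b by (simp_all add: popcount_sum_add_balanced)
    moreover have "popcount_sum p + popcount_sum q + min p q \<le> popcount_sum (p + q)"
      "popcount_sum p' + popcount_sum q' + min p' q' \<le> popcount_sum (p' + q')"
      by (rule less; use a b False in linarith)+
    moreover have "min a b + min p p' + min q' q
        \<le> min p q + min p' q' + min (p + q) (p' + q')"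
      using a b by linarith
    ultimately show ?thesis
      by linarith
  qed
qed

lemma popcount_sum_power2_add:
  "r \<le> 2 ^ m \<Longrightarrow> popcount_sum (2 ^ m + r) = popcount_sum (2 ^ m) + popcount_sum r + r"
  by (induction r) (simp_all add: popcount_power2_add)

lemma weighted_popcount_sum_power2_add:
  "r \<le> 2 ^ m \<Longrightarrow> weighted_popcount_sum (2 ^ m + r) = weighted_popcount_sum (2 ^ m)
    + weighted_popcount_sum r + 2 * 2 ^ m * popcount_sum r + r * r + 2 * 2 ^ m * r"
proof (induction r)
  case (Suc r)
  then have "popcount (2 ^ m + r) = Suc (popcount r)"
    by (simp add: popcount_power2_add)
  with Suc show ?case
    by (simp add: algebra_simps)
qed simp

lemma leading_digit_induct [consumes 1, case_names zero one weaken add]: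
  fixes k m :: nat
  assumes "k \<le> 2 ^ m"
    and zero: "P 0 0"
    and one: "P 0 1"
    and weaken: "\<And>m k. P m k \<Longrightarrow> P (Suc m) k"
    and add: "\<And>m r. r \<le> 2 ^ m \<Longrightarrow> P m (2 ^ m) \<Longrightarrow> P m r \<Longrightarrow> P (Suc m) (2 ^ m + r)"
  shows "P m k"
  using \<open>k \<le> 2 ^ m\<close>
proof (induction m arbitrary: k)
  case 0
  then have "k = 0 \<or> k = 1" by auto
  then show ?case
    using zero one by auto
next
  case (Suc m)
  show ?case
  proof (cases "k \<le> 2 ^ m")
    case True
    then show ?thesis
      by (intro weaken Suc.IH)
  next
    case False
    then obtain r where "k = 2 ^ m + r"
      using le_Suc_ex nat_le_linear by blast
    moreover from this have "r \<le> 2 ^ m"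
      using Suc.prems by simp
    ultimately show ?thesis
      by (simp add: add Suc.IH)
  qed
qed

lemma popcount_sum_le: "k \<le> 2 ^ m \<Longrightarrow> 2 * popcount_sum k \<le> m * k"
proof (induction rule: leading_digit_induct)
  case (add m r)
  then show ?case
    by (simp add: popcount_sum_power2_add distrib_left)
qed (simp_all add: popcount_def)

lemma weighted_popcount_sum_le: "k \<le> 2 ^ m \<Longrightarrow> 2 * weighted_popcount_sum k \<le> Suc m * (k * k)"
proof (induction rule: leading_digit_induct)
  case (add m r)
  define N :: nat where "N = 2 ^ m"
  have "2 * (N * popcount_sum r) \<le> N * (m * r)"
    using mult_le_mono2[OF popcount_sum_le[OF add.hyps], of N] by (simp only: mult.left_commute)
  moreover have "r * r \<le> N * N"
    using add.hyps by (auto simp: N_def intro: mult_le_mono)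
  moreover have "2 * weighted_popcount_sum N \<le> Suc m * (N * N)"
    "2 * weighted_popcount_sum r \<le> Suc m * (r * r)"
    using add.IH by (simp_all add: N_def)
  moreover have "weighted_popcount_sum (N + r) = weighted_popcount_sum N + weighted_popcount_sum r
      + 2 * (N * popcount_sum r) + r * r + 2 * (N * r)"
    using weighted_popcount_sum_power2_add[OF add.hyps] by (simp add: N_def)
  moreover have "Suc (Suc m) * ((N + r) * (N + r)) = Suc m * (N * N) + Suc m * (r * r) + N * N
      + r * r + 2 * (N * (m * r)) + 4 * (N * r)"
    by (simp add: algebra_simps)
  ultimately have "2 * weighted_popcount_sum (N + r) \<le> Suc (Suc m) * ((N + r) * (N + r))"
    by linarith
  then show ?case
    by (simp add: N_def)
qed (simp_all add: popcount_def)

section \<open>Edge boundaries in the cube\<close>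

definition flip :: "nat \<Rightarrow> bool list \<Rightarrow> bool list" where
  "flip i v = v[i := \<not> v ! i]"

lemma flip_Cons_0 [simp]: "flip 0 (b # v) = (\<not> b) # v"
  by (simp add: flip_def)

lemma flip_Cons_Suc [simp]: "flip (Suc i) (b # v) = b # flip i v"
  by (simp add: flip_def)

lemma flip_eq_flip_iff: "i < length v \<Longrightarrow> flip i v = flip j v \<longleftrightarrow> i = j"
  by (metis flip_def nth_list_update_eq nth_list_update_neq)

lemma cube_adj_iff_flip: "cube_adj n u v \<longleftrightarrow> u \<in> cube_vertices n \<and> (\<exists>i<n. v = flip i u)"
proof
  assume "cube_adj n u v"
  then have length: "length u = n" "length v = n" and "card {i. i < n \<and> u ! i \<noteq> v ! i} = 1"
    by (simp_all add: cube_adj_def cube_vertices_def)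
  from this(3) obtain i where "{i. i < n \<and> u ! i \<noteq> v ! i} = {i}"
    by (rule card_1_singletonE)
  then have "i < n" and "\<And>j. j < n \<Longrightarrow> v ! j = (if j = i then \<not> u ! j else u ! j)"
    by auto
  then have "v = flip i u"
    using length by (intro nth_equalityI) (simp_all add: flip_def nth_list_update)
  then show "u \<in> cube_vertices n \<and> (\<exists>i<n. v = flip i u)"
    using \<open>i < n\<close> length by (auto simp: cube_vertices_def)
next
  assume "u \<in> cube_vertices n \<and> (\<exists>i<n. v = flip i u)"
  then obtain i where "length u = n" "i < n" "v = flip i u"
    by (auto simp: cube_vertices_def)
  moreover from this have "{j. j < n \<and> u ! j \<noteq> v ! j} = {i}"
    by (auto simp: flip_def nth_list_update)
  ultimately show "cube_adj n u v"
    by (simp add: cube_adj_def cube_vertices_def flip_def)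
qed

lemma edge_boundary_eq_image_flip:
  assumes "S \<subseteq> cube_vertices n"
  shows "{e \<in> cube_edges n. card (e \<inter> S) = 1}
    = (\<lambda>(i, v). {v, flip i v}) ` (SIGMA i:{..<n}. {v \<in> S. flip i v \<notin> S})"
proof (intro equalityI subsetI)
  fix e assume "e \<in> {e \<in> cube_edges n. card (e \<inter> S) = 1}"
  then obtain u v where "e = {u, v}" "cube_adj n u v" "card ({u, v} \<inter> S) = 1"
    by (auto simp: cube_edges_def)
  moreover from this have "cube_adj n v u"
    by (simp add: cube_adj_def eq_commute conj_commute)
  moreover have "u \<noteq> v"
    using \<open>cube_adj n u v\<close> by (auto simp: cube_adj_def)
  then have "u \<in> S \<longleftrightarrow> v \<notin> S"
    using \<open>card ({u, v} \<inter> S) = 1\<close> by (cases "u \<in> S"; cases "v \<in> S") simp_all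
  ultimately obtain w x where "e = {w, x}" "cube_adj n w x" "w \<in> S" "x \<notin> S"
    by (cases "u \<in> S") auto
  then obtain i where "i < n" "w \<in> S" "flip i w \<notin> S" "e = {w, flip i w}"
    by (auto simp: cube_adj_iff_flip)
  then show "e \<in> (\<lambda>(i, v). {v, flip i v}) ` (SIGMA i:{..<n}. {v \<in> S. flip i v \<notin> S})"
    by force
next
  fix e assume "e \<in> (\<lambda>(i, v). {v, flip i v}) ` (SIGMA i:{..<n}. {v \<in> S. flip i v \<notin> S})"
  then obtain i v where "i < n" "v \<in> S" "flip i v \<notin> S" "e = {v, flip i v}"
    by auto
  then show "e \<in> {e \<in> cube_edges n. card (e \<inter> S) = 1}"
    using assms by (auto simp: cube_edges_def cube_adj_iff_flip)
qed

lemma theta_set_eq_sum_flip: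
  assumes "S \<subseteq> cube_vertices n"
  shows "theta_set n S = (\<Sum>i<n. card {v \<in> S. flip i v \<notin> S})"
proof -
  let ?exits = "SIGMA i:{..<n}. {v \<in> S. flip i v \<notin> S}"
  have "inj_on (\<lambda>(i, v). {v, flip i v}) ?exits"
    using assms by (auto simp: inj_on_def doubleton_eq_iff cube_vertices_def flip_eq_flip_iff)
  then have "theta_set n S = card ?exits"
    unfolding theta_set_def edge_boundary_eq_image_flip[OF assms] by (rule card_image)
  moreover have "finite S"
    using assms finite_cube_vertices by (rule finite_subset)
  ultimately show ?thesis
    by simp
qed

lemma card_eq_card_slices:
  assumes "S \<subseteq> cube_vertices (Suc n)"
  shows "card S = card (Cons False -` S) + card (Cons True -` S)"
proof -
  let ?slice = "\<lambda>b. Cons b ` (Cons b -` S)"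
  have "S = ?slice False \<union> ?slice True"
  proof (intro equalityI subsetI)
    fix v assume "v \<in> S"
    with assms obtain b w where "v = b # w"
      by (auto simp: cube_vertices_def length_Suc_conv)
    with \<open>v \<in> S\<close> show "v \<in> ?slice False \<union> ?slice True"
      by (cases b) auto
  qed auto
  moreover have "finite S"
    using assms finite_cube_vertices by (rule finite_subset)
  then have "finite (?slice b)" for b
    by (rule finite_subset[rotated]) auto
  moreover have "?slice False \<inter> ?slice True = {}"
    by auto
  ultimately have "card S = card (?slice False) + card (?slice True)"
    by (metis card_Un_disjoint)
  then show ?thesis
    by (simp add: card_image del: image_vimage_eq)
qed

lemma vimage_Cons_subset: "S \<subseteq> cube_vertices (Suc n) \<Longrightarrow> Cons b -` S \<subseteq> cube_vertices n"
  by (auto simp: cube_vertices_def)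

lemma theta_set_Suc:
  assumes "S \<subseteq> cube_vertices (Suc n)"
  defines "A \<equiv> Cons False -` S" and "B \<equiv> Cons True -` S"
  shows "theta_set (Suc n) S = theta_set n A + theta_set n B + (card (A - B) + card (B - A))"
proof -
  have card_split: "card {v \<in> S. P v} = card {v \<in> A. P (False # v)} + card {v \<in> B. P (True # v)}" for P
    using card_eq_card_slices[of "{v \<in> S. P v}" n] assms by (simp add: vimage_def subset_iff)
  have "card {v \<in> S. flip 0 v \<notin> S} = card (A - B) + card (B - A)"
    by (simp add: card_split) (simp add: A_def B_def set_diff_eq)
  moreover have "card {v \<in> S. flip (Suc i) v \<notin> S}
      = card {v \<in> A. flip i v \<notin> A} + card {v \<in> B. flip i v \<notin> B}" for i
    by (simp add: card_split) (simp add: A_def B_def)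
  ultimately show ?thesis
    using assms(1) unfolding A_def B_def
    by (simp add: theta_set_eq_sum_flip vimage_Cons_subset sum.lessThan_Suc_shift sum.distrib
        del: sum.lessThan_Suc)
qed

section \<open>The edge-isoperimetric theorem\<close>

lemma theta_set_ge:
  "S \<subseteq> cube_vertices n \<Longrightarrow> n * card S \<le> theta_set n S + 2 * popcount_sum (card S)"
proof (induction n arbitrary: S)
  case (Suc n)
  define A B where "A = Cons False -` S" and "B = Cons True -` S"
  have "A \<subseteq> cube_vertices n" "B \<subseteq> cube_vertices n"
    using Suc.prems by (simp_all add: A_def B_def vimage_Cons_subset)
  then have IH: "n * card A \<le> theta_set n A + 2 * popcount_sum (card A)"
    "n * card B \<le> theta_set n B + 2 * popcount_sum (card B)"
    and "finite A" "finite B"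
    using Suc.IH finite_cube_vertices finite_subset by blast+
  then have "card A - card B \<le> card (A - B)" "card B - card A \<le> card (B - A)"
    by (simp_all add: diff_card_le_card_Diff)
  then have "card A + card B \<le> card (A - B) + card (B - A) + 2 * min (card A) (card B)"
    by linarith
  moreover have "card S = card A + card B"
    and "theta_set (Suc n) S = theta_set n A + theta_set n B + (card (A - B) + card (B - A))"
    using Suc.prems by (simp_all add: A_def B_def card_eq_card_slices theta_set_Suc)
  ultimately show ?case
    using IH popcount_sum_superadditive[of "card A" "card B"] by (simp add: algebra_simps)
qed simp

definition initial_segment :: "nat \<Rightarrow> nat \<Rightarrow> bool list set" where
  "initial_segment n k = {v \<in> cube_vertices n. horner_sum of_bool 2 v < k}"

lemma initial_segment_subset: "initial_segment n k \<subseteq> cube_vertices n"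
  by (auto simp: initial_segment_def)

lemma finite_initial_segment: "finite (initial_segment n k)"
  using initial_segment_subset finite_cube_vertices by (rule finite_subset)

lemma initial_segment_mono: "i \<le> j \<Longrightarrow> initial_segment n i \<subseteq> initial_segment n j"
  by (auto simp: initial_segment_def)

lemma vimage_Cons_initial_segment:
  "Cons False -` initial_segment (Suc n) k = initial_segment n (Suc k div 2)"
  "Cons True -` initial_segment (Suc n) k = initial_segment n (k div 2)"
  by (auto simp: initial_segment_def cube_vertices_def)

lemma card_initial_segment: "k \<le> 2 ^ n \<Longrightarrow> card (initial_segment n k) = k"
proof (induction n arbitrary: k)
  case 0
  then have "k = 0 \<or> k = 1" by auto
  then show ?case
    by (auto simp: initial_segment_def cube_vertices_def cong: conj_cong)
next
  case (Suc n)
  have "card (initial_segment (Suc n) k) = Suc k div 2 + k div 2"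
    using Suc by (simp add: card_eq_card_slices[OF initial_segment_subset]
        vimage_Cons_initial_segment)
  then show ?case by presburger
qed

lemma theta_set_initial_segment:
  "k \<le> 2 ^ n \<Longrightarrow> theta_set n (initial_segment n k) + 2 * popcount_sum k = n * k"
proof (induction n arbitrary: k)
  case 0
  then have "k = 0 \<or> k = 1" by auto
  then show ?case
    by (auto simp: theta_set_eq_sum_flip initial_segment_subset popcount_def)
next
  case (Suc n)
  define p q where "p = Suc k div 2" and "q = k div 2"
  let ?P = "initial_segment n p" and ?Q = "initial_segment n q"
  have bounds: "p \<le> 2 ^ n" "q \<le> 2 ^ n" "q \<le> p" and k_eq: "k = p + q"
    using Suc.prems by (auto simp: p_def q_def)
  have "?Q \<subseteq> ?P"
    using bounds(3) by (rule initial_segment_mono)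
  then have "card (?P - ?Q) = p - q" "card (?Q - ?P) = 0"
    using bounds by (auto simp: card_Diff_subset finite_initial_segment card_initial_segment)
  then have "theta_set (Suc n) (initial_segment (Suc n) k)
      = theta_set n ?P + theta_set n ?Q + (p - q)"
    by (simp add: theta_set_Suc[OF initial_segment_subset] vimage_Cons_initial_segment
        flip: p_def q_def)
  moreover have "popcount_sum k = popcount_sum p + popcount_sum q + q"
    unfolding p_def q_def by (rule popcount_sum_halves)
  moreover have "theta_set n ?P + 2 * popcount_sum p = n * p"
    "theta_set n ?Q + 2 * popcount_sum q = n * q"
    using Suc.IH bounds by simp_all
  ultimately show ?case
    using bounds(3) k_eq by (simp add: algebra_simps)
qed

theorem theta_add_popcount_sum:
  assumes "k \<le> 2 ^ n"
  shows "theta n k + 2 * popcount_sum k = n * k"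
proof -
  have "theta n k = theta_set n (initial_segment n k)"
    unfolding theta_def
  proof (rule Min_eqI[OF finite_theta_candidates])
    show "theta_set n (initial_segment n k)
        \<in> {theta_set n S | S. S \<subseteq> cube_vertices n \<and> card S = k}"
      using assms initial_segment_subset card_initial_segment by blast
  next
    fix t assume "t \<in> {theta_set n S | S. S \<subseteq> cube_vertices n \<and> card S = k}"
    then have "n * k \<le> t + 2 * popcount_sum k"
      using theta_set_ge by blast
    then show "theta_set n (initial_segment n k) \<le> t"
      using theta_set_initial_segment[OF assms] by linarith
  qed
  then show ?thesis
    using theta_set_initial_segment[OF assms] by simp
qed

lemma theta_Suc:
  assumes "k < 2 ^ n"
  shows "theta n (Suc k) + 2 * popcount k = theta n k + n"
  using theta_add_popcount_sum[of k n] theta_add_popcount_sum[of "Suc k" n] assms by simp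

lemma theta_summation_by_parts:
  "k \<le> 2 ^ n \<Longrightarrow>
    (2 * k + 1) * theta n k + 2 * weighted_popcount_sum k = 2 * (\<Sum>i=0..k. theta n i) + n * (k * k)"
proof (induction k)
  case 0
  show ?case
    using theta_add_popcount_sum[of 0 n] by simp
next
  case (Suc k)
  have "(2 * k + 1) * (theta n (Suc k) + 2 * popcount k) = (2 * k + 1) * (theta n k + n)"
    using Suc.prems by (simp add: theta_Suc)
  moreover have "(2 * k + 1) * theta n k + 2 * weighted_popcount_sum k
      = 2 * (\<Sum>i=0..k. theta n i) + n * (k * k)"
    using Suc by simp
  ultimately show ?case
    by (simp add: algebra_simps)
qed

theorem theorem4p2:
  fixes n k :: nat
  assumes "n \<ge> 1" and "k \<le> 2 ^ (n - 1)"
  shows "(2 * k + 1) * theta n k \<ge> 2 * (\<Sum>i=0..k. theta n i)"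
proof -
  have "(2::nat) ^ (n - 1) \<le> 2 ^ n"
    by (rule power_increasing) simp_all
  with assms(2) have "k \<le> 2 ^ n"
    by (rule order_trans)
  then have "(2 * k + 1) * theta n k + 2 * weighted_popcount_sum k
      = 2 * (\<Sum>i=0..k. theta n i) + n * (k * k)"
    by (rule theta_summation_by_parts)
  moreover have "2 * weighted_popcount_sum k \<le> n * (k * k)"
    using weighted_popcount_sum_le[OF assms(2)] assms(1) by simp
  ultimately show ?thesis
    by linarith
qed

end
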